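(* The Poisson rounding scheme is $(1-1/e)$-approximate when player valuations are submodular. That is, let $v_1,\dots,v_n:2^{[m]}\to\mathbb{R}_{\ge 0}$ be normalized ($v_i(\emptyset)=0$), monotone, submodular set functions. Then for every allocation $(S_1,\dots,S_n)$, with indicator vector $x\in\{0,1\}^{n\times m}$ ($x_{ij}=1$ iff $j\in S_i$), $$\sum_{i=1}^n v_i(S_i)\ \ge\ \mathbf{E}_{(S_1',\dots,S_n')\sim r_{\mathrm{poiss}}(x)}\Big[\sum_{i=1}^n v_i(S_i')\Big]\ \ge\ \Big(1-\frac1e\Big)\sum_{i=1}^n v_i(S_i).$$
   Context: An allocation of items $[m]=\{1,\dots,m\}$ to players $[n]=\{1,\dots,n\}$ is a tuple $(S_1,\dots,S_n)$ of pairwise disjoint subsets of $[m]$. The Poisson rounding scheme $r_{\mathrm{poiss}}$ maps each $x\in\mathcal{R}=\{x\in[0,1]^{n\times m}:\sum_i x_{ij}\le 1\ \forall j\in[m]\}$ to a random allocation: independently for each item $j$, assign $j$ to player $i$ with probability $1-e^{-x_{ij}}$ (for each $i\in[n]$), and leave $j$ unassigned with the remaining probability. A set function $v$ is monotone if $v(A)\le v(B)$ whenever $A\subseteq B$, and submodular if $v(S\cap T)+v(S\cup T)\le v(S)+v(T)$ for all $S,T$. *)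

theory Defs
  imports "HOL-Probability.Probability"
begin

text \<open>
  Players are \<open>{1..n}\<close> and items are \<open>{1..m}\<close>. A tuple indexed by the players is a function on
  \<open>nat\<close> of which only the values on \<open>{1..n}\<close> matter; likewise only the entries \<open>x i j\<close> with
  \<open>i \<in> {1..n}\<close>, \<open>j \<in> {1..m}\<close> of a matrix matter.
\<close>

definition allocation :: "nat \<Rightarrow> nat \<Rightarrow> (nat \<Rightarrow> nat set) \<Rightarrow> bool" where
  "allocation n m S \<longleftrightarrow> (\<forall>i\<in>{1..n}. S i \<subseteq> {1..m}) \<and> disjoint_family_on S {1..n}"

definition fractional_allocations :: "nat \<Rightarrow> nat \<Rightarrow> (nat \<Rightarrow> nat \<Rightarrow> real) set" where
  "fractional_allocations n m =
     {x. (\<forall>i\<in>{1..n}. \<forall>j\<in>{1..m}. 0 \<le> x i j \<and> x i j \<le> 1) \<and>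
         (\<forall>j\<in>{1..m}. (\<Sum>i=1..n. x i j) \<le> 1)}"

definition allocation_vector :: "(nat \<Rightarrow> nat set) \<Rightarrow> nat \<Rightarrow> nat \<Rightarrow> real" where
  "allocation_vector S i j = (if j \<in> S i then 1 else 0)"

definition submodular_on :: "'a set \<Rightarrow> ('a set \<Rightarrow> real) \<Rightarrow> bool" where
  "submodular_on E v \<longleftrightarrow>
     (\<forall>S T. S \<subseteq> E \<longrightarrow> T \<subseteq> E \<longrightarrow> v (S \<inter> T) + v (S \<union> T) \<le> v S + v T)"

text \<open>
  The player receiving item \<open>j\<close>; \<open>None\<close> means that \<open>j\<close> stays unassigned. The argument of
  \<open>embed_pmf\<close> is a probability mass function for every \<open>x\<close> in \<open>fractional_allocations n m\<close> and
  every item \<open>j\<close>; see \<open>pmf_poisson_item\<close>.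
\<close>

definition poisson_item :: "nat \<Rightarrow> (nat \<Rightarrow> nat \<Rightarrow> real) \<Rightarrow> nat \<Rightarrow> nat option pmf" where
  "poisson_item n x j = embed_pmf (\<lambda>z. case z of
       None \<Rightarrow> 1 - (\<Sum>i=1..n. 1 - exp (- x i j))
     | Some i \<Rightarrow> if i \<in> {1..n} then 1 - exp (- x i j) else 0)"

definition poisson_rounding ::
    "nat \<Rightarrow> nat \<Rightarrow> (nat \<Rightarrow> nat \<Rightarrow> real) \<Rightarrow> (nat \<Rightarrow> nat set) pmf" where
  "poisson_rounding n m x =
     map_pmf (\<lambda>f i. {j\<in>{1..m}. f j = Some i}) (Pi_pmf {1..m} None (poisson_item n x))"

lemma pmf_poisson_item:
  assumes x: "x \<in> fractional_allocations n m" and j: "j \<in> {1..m}"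
  shows "pmf (poisson_item n x j) z = (case z of
       None \<Rightarrow> 1 - (\<Sum>i=1..n. 1 - exp (- x i j))
     | Some i \<Rightarrow> if i \<in> {1..n} then 1 - exp (- x i j) else 0)" (is "_ = ?p z")
proof -
  have le: "(\<Sum>i=1..n. 1 - exp (- x i j)) \<le> 1"
  proof -
    have "1 - exp (- x i j) \<le> x i j" for i
      using exp_ge_add_one_self[of "- x i j"] by linarith
    then have "(\<Sum>i=1..n. 1 - exp (- x i j)) \<le> (\<Sum>i=1..n. x i j)"
      by (intro sum_mono)
    also have "\<dots> \<le> 1"
      using x j by (auto simp: fractional_allocations_def)
    finally show ?thesis .
  qed
  have nonneg: "0 \<le> ?p z" for z
    using x j le by (auto simp: fractional_allocations_def split: option.splits)
  let ?A = "insert None (Some ` {1..n})"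
  have "(\<integral>\<^sup>+ z. ennreal (?p z) \<partial>count_space UNIV) = (\<Sum>z\<in>?A. ennreal (?p z))"
    by (rule nn_integral_count_space') (auto split: option.splits if_splits)
  also have "\<dots> = ennreal (\<Sum>z\<in>?A. ?p z)"
    using nonneg by (intro sum_ennreal) auto
  also have "(\<Sum>z\<in>?A. ?p z) = 1"
    by (simp add: sum.reindex)
  finally have "(\<integral>\<^sup>+ z. ennreal (?p z) \<partial>count_space UNIV) = 1"
    by simp
  then show ?thesis
    unfolding poisson_item_def using nonneg by (intro pmf_embed_pmf)
qed

lemma allocation_vector_fractional:
  assumes "allocation n m S"
  shows "allocation_vector S \<in> fractional_allocations n m"
proof -
  have "(\<Sum>i=1..n. allocation_vector S i j) \<le> 1" for j
  proof -
    have "(\<Sum>i=1..n. allocation_vector S i j) = real (card {i\<in>{1..n}. j \<in> S i})"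
      by (simp add: allocation_vector_def sum.If_cases Int_def)
    moreover have "card {i\<in>{1..n}. j \<in> S i} \<le> Suc 0"
      using assms unfolding allocation_def disjoint_family_on_def
      by (subst card_le_Suc0_iff_eq) (simp, blast)
    ultimately show ?thesis by simp
  qed
  then show ?thesis
    by (auto simp: fractional_allocations_def allocation_vector_def)
qed

lemma allocation_poisson_rounding:
  assumes "S \<in> set_pmf (poisson_rounding n m x)"
  shows "allocation n m S"
  using assms
  by (auto simp: poisson_rounding_def allocation_def disjoint_family_on_def)

end

theory Submission imports Defs begin

text \<open>
  Rounding the indicator vector of an allocation keeps every item \<open>j \<in> S i\<close> with player \<open>i\<close> with
  probability \<open>p = 1 - 1/e\<close> and gives player \<open>i\<close> nothing outside \<open>S i\<close>. Monotonicity gives the upper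
  bound. For the lower bound, add the items of \<open>S i\<close> one at a time: by submodularity, the marginal
  value of \<open>j\<close> over the part of the earlier items that survived is at least its marginal value over
  all earlier items. So each item contributes in expectation at least \<open>p\<close> times the latter, and
  these marginal values telescope to \<open>v (S i)\<close>. Independence of the items plays no role.
\<close>

text \<open>\<open>R \<omega> \<inter> A\<close> ranges over the finite set \<open>Pow A\<close>, so
  the sum of all \<open>\<bar>v B\<bar>\<close> over \<open>B \<in> Pow A\<close> is a constant
  bound.\<close>

lemma integrable_measure_pmf_Int_finite:
  fixes v :: "'a set \<Rightarrow> real" and R :: "'b \<Rightarrow> 'a set"
  assumes "finite A"
  shows "integrable (measure_pmf M) (\<lambda>\<omega>. v (R \<omega> \<inter> A))"
proof (rule measure_pmf.integrable_const_bound)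
  have "norm (v (R \<omega> \<inter> A)) \<le> (\<Sum>B\<in>Pow A. \<bar>v B\<bar>)" for \<omega>
    using member_le_sum[of "R \<omega> \<inter> A" "Pow A" "\<lambda>B. \<bar>v B\<bar>"] assms by auto
  then show "AE \<omega> in measure_pmf M. norm (v (R \<omega> \<inter> A)) \<le> (\<Sum>B\<in>Pow A. \<bar>v B\<bar>)"
    by simp
qed simp

text \<open>For \<open>j \<in> R\<close> this is submodularity for the pair
  \<open>insert j (R \<inter> A)\<close> and \<open>A\<close>, whose intersection is
  \<open>R \<inter> A\<close> because \<open>j \<notin> A\<close>. For \<open>j \<notin> R\<close>
  both sides coincide.\<close>

lemma submodular_on_insert_Int:
  assumes "submodular_on E v" "insert j A \<subseteq> E" "j \<notin> A"
  shows "v (R \<inter> A) + indicator R j * (v (insert j A) - v A) \<le> v (R \<inter> insert j A)"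
proof (cases "j \<in> R")
  case True
  have "v (insert j (R \<inter> A) \<inter> A) + v (insert j (R \<inter> A) \<union> A) \<le> v (insert j (R \<inter> A)) + v A"
    using assms(1)[unfolded submodular_on_def, rule_format, of "insert j (R \<inter> A)" A] assms(2)
    by blast
  moreover have "insert j (R \<inter> A) \<inter> A = R \<inter> A" "insert j (R \<inter> A) \<union> A = insert j A"
      "R \<inter> insert j A = insert j (R \<inter> A)"
    using True assms(3) by blast+
  ultimately show ?thesis using True by simp
next
  case False
  then have "R \<inter> insert j A = R \<inter> A" by auto
  then show ?thesis using False by simp
qed

text \<open>Cutting \<open>R \<omega>\<close> down to \<open>A\<close> lets the induction over
  \<open>A\<close> keep one and the same random set: passing to \<open>insert j A\<close> only
  reveals whether \<open>j\<close> survives.\<close>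

lemma submodular_on_expectation_Int_ge:
  fixes R :: "'b \<Rightarrow> 'a set"
  assumes "finite A" and "A \<subseteq> E" and "submodular_on E v" and "v {} = 0"
    and "\<And>j. j \<in> A \<Longrightarrow> measure_pmf.prob M {\<omega>. j \<in> R \<omega>} = p"
  shows "p * v A \<le> measure_pmf.expectation M (\<lambda>\<omega>. v (R \<omega> \<inter> A))"
  using assms
proof (induction A rule: finite_induct)
  case empty
  then show ?case by simp
next
  case (insert j A)
  let ?d = "v (insert j A) - v A"
  let ?I = "indicator {\<omega>. j \<in> R \<omega>} :: 'b \<Rightarrow> real"
  have int_A: "integrable (measure_pmf M) (\<lambda>\<omega>. v (R \<omega> \<inter> A))"
    using insert.hyps(1) by (rule integrable_measure_pmf_Int_finite)
  have int_I: "integrable (measure_pmf M) (\<lambda>\<omega>. ?I \<omega> * ?d)"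
    by (intro integrable_mult_left integrable_real_indicator) (auto simp: measure_pmf.emeasure_eq_measure)
  have "p * v A \<le> measure_pmf.expectation M (\<lambda>\<omega>. v (R \<omega> \<inter> A))"
    using insert.prems by (intro insert.IH) auto
  then have "p * v (insert j A) \<le> measure_pmf.expectation M (\<lambda>\<omega>. v (R \<omega> \<inter> A)) + p * ?d"
    by (simp add: algebra_simps)
  \<comment> \<open>Writing \<open>p\<close> as the expectation of the indicator of survival puts
    both summands under one integral, where the pointwise marginal bound applies.\<close>
  also have "p * ?d = measure_pmf.expectation M (\<lambda>\<omega>. ?I \<omega> * ?d)"
    using insert.prems(4)[of j] by simp
  also have "measure_pmf.expectation M (\<lambda>\<omega>. v (R \<omega> \<inter> A)) + \<dots> =
      measure_pmf.expectation M (\<lambda>\<omega>. v (R \<omega> \<inter> A) + ?I \<omega> * ?d)"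
    using int_A int_I by (rule Bochner_Integration.integral_add[symmetric])
  also have "\<dots> \<le> measure_pmf.expectation M (\<lambda>\<omega>. v (R \<omega> \<inter> insert j A))"
  proof (rule integral_mono)
    show "integrable (measure_pmf M) (\<lambda>\<omega>. v (R \<omega> \<inter> insert j A))"
      using insert.hyps(1) by (intro integrable_measure_pmf_Int_finite) simp
    show "v (R \<omega> \<inter> A) + ?I \<omega> * ?d \<le> v (R \<omega> \<inter> insert j A)" for \<omega>
      using submodular_on_insert_Int[OF insert.prems(2,1) insert.hyps(2), of "R \<omega>"]
      by (simp add: indicator_def)
  qed (use int_A int_I in simp)
  finally show ?case .
qed

text \<open>The event depends only on coordinate \<open>j\<close> of the product distribution, and
  the marginal there is \<open>poisson_item n x j\<close>.\<close>

lemma prob_poisson_rounding: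
  assumes "x \<in> fractional_allocations n m" "i \<in> {1..n}" "j \<in> {1..m}"
  shows "measure_pmf.prob (poisson_rounding n m x) {S'. j \<in> S' i} = 1 - exp (- x i j)"
proof -
  have "measure_pmf.prob (poisson_rounding n m x) {S'. j \<in> S' i} =
      measure_pmf.prob (map_pmf (\<lambda>f. f j) (Pi_pmf {1..m} None (poisson_item n x))) {Some i}"
    using assms(3) by (simp add: poisson_rounding_def vimage_def)
  also have "\<dots> = pmf (poisson_item n x j) (Some i)"
    using assms(3) by (simp add: Pi_pmf_component measure_pmf_single)
  also have "\<dots> = 1 - exp (- x i j)"
    using assms(2) by (simp add: pmf_poisson_item[OF assms(1,3)])
  finally show ?thesis .
qed

text \<open>An outcome in the support has positive mass, so \<open>j \<in> S' i\<close> has positive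
  probability; for \<open>j \<notin> S i\<close> that probability would be
  \<open>1 - exp 0 = 0\<close>.\<close>

lemma set_pmf_poisson_rounding_subset:
  assumes alloc: "allocation n m S" and i: "i \<in> {1..n}"
    and S': "S' \<in> set_pmf (poisson_rounding n m (allocation_vector S))"
  shows "S' i \<subseteq> S i"
proof
  fix j assume j: "j \<in> S' i"
  then have jm: "j \<in> {1..m}"
    using allocation_poisson_rounding[OF S'] i unfolding allocation_def by blast
  have "0 < pmf (poisson_rounding n m (allocation_vector S)) S'"
    using S' by (simp add: pmf_positive_iff)
  also have "\<dots> \<le> measure_pmf.prob (poisson_rounding n m (allocation_vector S)) {S'. j \<in> S' i}"
    unfolding measure_pmf_single[symmetric]
    using j by (intro measure_pmf.finite_measure_mono) auto
  finally have "allocation_vector S i j \<noteq> 0"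
    using prob_poisson_rounding[OF allocation_vector_fractional[OF alloc] i jm] by auto
  then show "j \<in> S i"
    by (simp add: allocation_vector_def split: if_splits)
qed

theorem lemma4p3:
  fixes n m :: nat
    and v :: "nat \<Rightarrow> nat set \<Rightarrow> real"
    and S :: "nat \<Rightarrow> nat set"
  assumes nonneg: "\<And>i A. i \<in> {1..n} \<Longrightarrow> A \<subseteq> {1..m} \<Longrightarrow> 0 \<le> v i A"
    and normalized: "\<And>i. i \<in> {1..n} \<Longrightarrow> v i {} = 0"
    and monotone: "\<And>i. i \<in> {1..n} \<Longrightarrow> mono_on (Pow {1..m}) (v i)"
    and submodular: "\<And>i. i \<in> {1..n} \<Longrightarrow> submodular_on {1..m} (v i)"
    and alloc: "allocation n m S"
  shows "(\<Sum>i=1..n. v i (S i)) \<ge>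
           measure_pmf.expectation (poisson_rounding n m (allocation_vector S))
             (\<lambda>S'. \<Sum>i=1..n. v i (S' i)) \<and>
         measure_pmf.expectation (poisson_rounding n m (allocation_vector S))
             (\<lambda>S'. \<Sum>i=1..n. v i (S' i)) \<ge>
           (1 - 1 / exp 1) * (\<Sum>i=1..n. v i (S i))"
proof -
  let ?M = "poisson_rounding n m (allocation_vector S)"
  let ?E = "\<lambda>i. measure_pmf.expectation ?M (\<lambda>S'. v i (S' i \<inter> S i))"
  have sub: "S i \<subseteq> {1..m}" if "i \<in> {1..n}" for i
    using alloc that unfolding allocation_def by blast
  then have fin: "finite (S i)" if "i \<in> {1..n}" for i
    using that finite_subset by blast
  have int: "integrable (measure_pmf ?M) (\<lambda>S'. v i (S' i \<inter> S i))" if "i \<in> {1..n}" for i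
    by (intro integrable_measure_pmf_Int_finite fin that)
  \<comment> \<open>On the support, intersecting with \<open>S i\<close> changes nothing, and it
    brings the integrand into the form that the integrability and expectation lemmas need.\<close>
  have "measure_pmf.expectation ?M (\<lambda>S'. \<Sum>i=1..n. v i (S' i)) =
      measure_pmf.expectation ?M (\<lambda>S'. \<Sum>i=1..n. v i (S' i \<inter> S i))"
    using set_pmf_poisson_rounding_subset[OF alloc]
    by (intro integral_cong_AE) (auto simp: AE_measure_pmf_iff Int_absorb2 intro!: sum.cong)
  also have "\<dots> = (\<Sum>i=1..n. ?E i)"
    using int by (rule Bochner_Integration.integral_sum)
  finally have E: "measure_pmf.expectation ?M (\<lambda>S'. \<Sum>i=1..n. v i (S' i)) = (\<Sum>i=1..n. ?E i)" .
  have "?E i \<le> v i (S i)" if i: "i \<in> {1..n}" for i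
  proof (rule measure_pmf.integral_le_const[OF int[OF i]])
    have "v i (S' i \<inter> S i) \<le> v i (S i)" for S'
      using sub[OF i] by (intro mono_onD[OF monotone[OF i]]) auto
    then show "AE S' in measure_pmf ?M. v i (S' i \<inter> S i) \<le> v i (S i)"
      by simp
  qed
  then have upper: "(\<Sum>i=1..n. ?E i) \<le> (\<Sum>i=1..n. v i (S i))"
    by (rule sum_mono)
  have "(1 - 1 / exp 1) * v i (S i) \<le> ?E i" if i: "i \<in> {1..n}" for i
  proof (rule submodular_on_expectation_Int_ge[OF fin[OF i] sub[OF i] submodular[OF i] normalized[OF i]])
    \<comment> \<open>The matrix entry is 1 for \<open>j \<in> S i\<close>, so the survival
      probability is \<open>1 - exp (- 1)\<close>.\<close>
    show "measure_pmf.prob ?M {S'. j \<in> S' i} = 1 - 1 / exp 1" if "j \<in> S i" for j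
      using prob_poisson_rounding[OF allocation_vector_fractional[OF alloc] i, of j] sub[OF i] that
      by (auto simp: allocation_vector_def exp_minus inverse_eq_divide)
  qed
  then have "(1 - 1 / exp 1) * (\<Sum>i=1..n. v i (S i)) \<le> (\<Sum>i=1..n. ?E i)"
    unfolding sum_distrib_left by (rule sum_mono)
  with upper show ?thesis
    unfolding E by blast
qed

end
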